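(* Let $q$ be a prime power, let $f(X)=X^2+bX+c$ be an irreducible quadratic polynomial over $\mathbb F_q$, and let $\{U_n\}_{n\ge0}$ be the Lucas sequence of the first type associated to $f(X)$. Assume that $r\ge1$ is the smallest positive integer such that $U_r=0$. Then the binomial order of $f(X)$ is $r$ and the minimal binomial multiple of $f(X)$ is $X^r+cU_{r-1}$.
   Context: The Lucas sequence of the first type associated to $f(X)=X^2+bX+c$ is defined by $U_0=0$, $U_1=1$, and $U_n=-bU_{n-1}-cU_{n-2}$ for $n\ge2$ (elements of $\mathbb F_q$). For a nonconstant monic polynomial $f\in\mathbb F_q[X]$ with nonzero constant term, the minimal binomial multiple of $f$ is the monic binomial $X^r-\lambda\in\mathbb F_q[X]$ (with $\lambda\neq0$) of lowest degree among the binomials over $\mathbb F_q$ divisible by $f$; its degree $r$ is the binomial order of $f$. *)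

theory Defs
  imports "HOL-Computational_Algebra.Computational_Algebra"
begin

(* Lucas sequence of the first type associated to X^2 + b X + c *)
fun lucas_U :: "'a::comm_ring_1 \<Rightarrow> 'a \<Rightarrow> nat \<Rightarrow> 'a" where
  "lucas_U b c 0 = 0"
| "lucas_U b c (Suc 0) = 1"
| "lucas_U b c (Suc (Suc n)) = - b * lucas_U b c (Suc n) - c * lucas_U b c n"

(* The exponent must be positive: otherwise X^0 - 1 = 0 would count as a binomial,
   and it is a multiple of every polynomial. *)
definition monic_binomial :: "'a::comm_ring_1 poly \<Rightarrow> bool" where
  "monic_binomial p \<longleftrightarrow> (\<exists>n l. n > 0 \<and> l \<noteq> 0 \<and> p = monom 1 n - [:l:])"

definition is_minimal_binomial_multiple :: "'a::field poly \<Rightarrow> 'a poly \<Rightarrow> bool" where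
  "is_minimal_binomial_multiple f p \<longleftrightarrow>
     monic_binomial p \<and> f dvd p \<and>
     (\<forall>p'. monic_binomial p' \<and> f dvd p' \<longrightarrow> degree p \<le> degree p')"

(* Meaningful for nonconstant f with nonzero constant term over a finite field; see
   minimal_binomial_multiple_ex1 below for existence and uniqueness. *)
definition minimal_binomial_multiple :: "'a::field poly \<Rightarrow> 'a poly" where
  "minimal_binomial_multiple f = (THE p. is_minimal_binomial_multiple f p)"

definition binomial_order :: "'a::field poly \<Rightarrow> nat" where
  "binomial_order f = degree (minimal_binomial_multiple f)"

lemma degree_monic_binomial:
  assumes "n > 0"
  shows "degree (monom 1 n - [:l:] :: 'a::comm_ring_1 poly) = n"
proof -
  have "degree [:l:] < degree (monom (1::'a) n)"
    using assms by (simp add: degree_monom_eq)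
  then have "degree (monom 1 n + - [:l:]) = degree (monom (1::'a) n)"
    by (intro degree_add_eq_left) simp
  then show ?thesis
    by (simp only: degree_monom_eq[OF one_neq_zero] add_uminus_conv_diff)
qed

lemma dvd_monom_mult_cancel:
  fixes f g :: "'a::field poly"
  assumes "coeff f 0 \<noteq> 0" and "f dvd monom 1 i * g"
  shows "f dvd g"
  using assms(2)
proof (induction i)
  case 0
  then show ?case by simp
next
  case (Suc i)
  from Suc.prems obtain h where h: "monom 1 (Suc i) * g = f * h" by (auto elim: dvdE)
  have eq: "pCons 0 (monom 1 i * g) = f * h"
    using h by (simp add: monom_Suc)
  then have "coeff f 0 * coeff h 0 = 0"
    by (metis coeff_pCons_0 mult_poly_0_left coeff_mult_0)
  then obtain h' where h': "h = pCons 0 h'"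
    using assms(1) by (cases h) auto
  have "monom 1 i * g = f * h'" using eq h' by simp
  then show ?case by (intro Suc.IH) simp
qed

lemma finite_poly_degree_le: "finite {p :: 'a::{finite,comm_ring_1} poly. degree p \<le> n}"
proof -
  have "{p :: 'a poly. degree p \<le> n} \<subseteq> Poly ` {xs. set xs \<subseteq> UNIV \<and> length xs \<le> Suc n}"
  proof
    fix p :: "'a poly" assume "p \<in> {p. degree p \<le> n}"
    then have "length (coeffs p) \<le> Suc n"
      by (cases "p = 0") (auto simp: length_coeffs_degree)
    then show "p \<in> Poly ` {xs. set xs \<subseteq> UNIV \<and> length xs \<le> Suc n}"
      by (intro image_eqI[where x = "coeffs p"]) auto
  qed
  then show ?thesis
    by (rule finite_subset) (intro finite_imageI finite_lists_length_le finite)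
qed

lemma minimal_binomial_multiple_ex1:
  fixes f :: "'a::finite_field poly"
  assumes deg: "degree f > 0" and const: "coeff f 0 \<noteq> 0"
  shows "\<exists>!p. is_minimal_binomial_multiple f p"
proof -
  have "\<exists>p. monic_binomial p \<and> f dvd p"
  proof -
    let ?r = "\<lambda>n::nat. monom 1 n mod f"
    have "degree (?r n) \<le> degree f" for n
      using degree_mod_less'[of f "monom 1 n"] deg by (cases "?r n = 0") force+
    then have "finite (range ?r)"
      by (intro finite_subset[OF _ finite_poly_degree_le[of "degree f"]]) auto
    then have "\<not> inj ?r"
      using finite_imageD infinite_UNIV_nat by blast
    then obtain i j where ij: "i < j" "?r i = ?r j"
      unfolding inj_on_def by (metis linorder_neqE_nat)
    have "f dvd monom 1 j - monom 1 i"
      using ij(2) by (metis mod_eq_dvd_iff)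
    also have "monom 1 j - monom 1 i = monom 1 i * (monom 1 (j - i) - [:1::'a:])"
      using ij(1) by (simp add: algebra_simps mult_monom)
    finally have "f dvd monom 1 (j - i) - [:1:]"
      by (rule dvd_monom_mult_cancel[OF const])
    moreover have "monic_binomial (monom 1 (j - i) - [:1::'a:])"
      unfolding monic_binomial_def using ij(1)
      by (intro exI[of _ "j - i"] exI[of _ 1]) simp
    ultimately show ?thesis by blast
  qed
  then obtain p where p: "is_minimal_binomial_multiple f p"
    unfolding is_minimal_binomial_multiple_def
    using exists_least_iff[of "\<lambda>n. \<exists>p. monic_binomial p \<and> f dvd p \<and> degree p = n"]
    by (metis linorder_not_less)
  have "p' = p" if p': "is_minimal_binomial_multiple f p'" for p'
  proof -
    have d: "degree p' = degree p"
      using p p' unfolding is_minimal_binomial_multiple_def by (meson order_antisym)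
    obtain n l where nl: "n > 0" "p = monom 1 n - [:l:]"
      using p unfolding is_minimal_binomial_multiple_def monic_binomial_def by blast
    obtain n' l' where nl': "n' > 0" "p' = monom 1 n' - [:l':]"
      using p' unfolding is_minimal_binomial_multiple_def monic_binomial_def by blast
    have n: "n' = n" using d nl nl' by (simp add: degree_monic_binomial)
    have "f dvd p - p'"
      using p p' unfolding is_minimal_binomial_multiple_def by (auto intro: dvd_diff)
    also have "p - p' = [:l' - l:]" using nl nl' n by simp
    finally have "[:l' - l:] = 0"
      using deg dvd_imp_degree_le[of f "[:l' - l:]"] by auto
    then show ?thesis using nl nl' n by simp
  qed
  with p show ?thesis by blast
qed

end

(* Modulo f = X^2 + b X + c one has X^n = U_n X - c U_(n-1) for n >= 1. As deg f = 2,
   f divides X^n - l iff U_n = 0 and l = - c U_(n-1). *)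
theory Submission
  imports Defs
begin

text \<open>Multiplying by X and reducing X^2 to -bX - c turns the remainders of the powers of X
  into the Lucas recurrence (\<open>dvd_monom_diff_lucas\<close>). Since 1 and X are independent
  modulo f, the powers congruent to a constant are those with U_n = 0, and this determines the
  constant (\<open>quadratic_dvd_binomial_iff\<close>). So no binomial multiple has degree below r;
  at r the constant is nonzero, because c and U_(r-1) are.\<close>

lemma dvd_monom_diff_lucas:
  fixes b c :: "'a::comm_ring_1"
  shows "[:c, b, 1:] dvd monom 1 (Suc n) - [:- c * lucas_U b c n, lucas_U b c (Suc n):]"
proof (induction n)
  case 0
  then show ?case by (simp add: monom_Suc one_pCons)
next
  case (Suc n)
  let ?U = "lucas_U b c"
  \<comment> \<open>The multiple of f cancels the X^2 term produced by the shift; the X coefficient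
    left over is b U_(n+1) + c U_n = -U_(n+2).\<close>
  have "monom 1 (Suc (Suc n)) - [:- c * ?U (Suc n), ?U (Suc (Suc n)):]
      = [:0, 1:] * (monom 1 (Suc n) - [:- c * ?U n, ?U (Suc n):]) + [:?U (Suc n):] * [:c, b, 1:]"
    by (simp add: monom_Suc algebra_simps)
  also have "[:c, b, 1:] dvd \<dots>"
    by (intro dvd_add dvd_mult Suc.IH dvd_refl)
  finally show ?case .
qed

text \<open>The difference from the known multiple of f is \<open>?d\<close>, of degree at most 1,
  which the quadratic f divides only if it vanishes.\<close>

lemma quadratic_dvd_binomial_iff:
  fixes b c :: "'a::field"
  shows "[:c, b, 1:] dvd monom 1 (Suc n) - [:l:] \<longleftrightarrow>
    lucas_U b c (Suc n) = 0 \<and> l = - c * lucas_U b c n"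
proof -
  let ?f = "[:c, b, 1:]" and ?d = "[:- c * lucas_U b c n - l, lucas_U b c (Suc n):]"
  have "monom 1 (Suc n) - [:l:]
      = (monom 1 (Suc n) - [:- c * lucas_U b c n, lucas_U b c (Suc n):]) + ?d"
    by simp
  then have "?f dvd monom 1 (Suc n) - [:l:] \<longleftrightarrow> ?f dvd ?d"
    by (metis dvd_add_right_iff dvd_monom_diff_lucas)
  also have "\<dots> \<longleftrightarrow> ?d = 0"
  proof
    assume "?f dvd ?d"
    moreover have "degree ?d < degree ?f" by simp
    ultimately show "?d = 0" using dvd_imp_degree_le not_less by blast
  qed simp
  finally show ?thesis by auto
qed

text \<open>Otherwise X would split off as a proper factor.\<close>

lemma irreducible_quadratic_const_nonzero:
  fixes b c :: "'a::field"
  assumes "irreducible [:c, b, 1:]"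
  shows "c \<noteq> 0"
proof
  assume "c = 0"
  then have "[:c, b, 1:] = [:0, 1:] * [:b, 1:]" by simp
  then have "is_unit [:0, 1::'a:] \<or> is_unit [:b, 1:]"
    using assms by (metis irreducibleD)
  then show False by (simp add: is_unit_iff_degree)
qed

theorem corollary3p15:
  fixes b c :: "'a::finite_field" and r :: nat
  assumes "irreducible [:c, b, 1:]"
    and "r \<ge> 1"
    and "lucas_U b c r = 0"
    and "\<And>n. 1 \<le> n \<Longrightarrow> n < r \<Longrightarrow> lucas_U b c n \<noteq> 0"
  shows "binomial_order [:c, b, 1:] = r \<and>
    minimal_binomial_multiple [:c, b, 1:] = monom 1 r + [:c * lucas_U b c (r - 1):]"
proof -
  let ?f = "[:c, b, 1:]" and ?l = "- c * lucas_U b c (r - 1)"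
  let ?p = "monom 1 r - [:?l:]"
  have c: "c \<noteq> 0" using assms(1) by (rule irreducible_quadratic_const_nonzero)
  \<comment> \<open>As U_1 = 1, the index r - 1 is still positive, so the minimality of r gives
    U_(r-1) \<noteq> 0.\<close>
  have "r \<noteq> 1" using assms(3) by auto
  then have l: "?l \<noteq> 0" using c assms(2) assms(4)[of "r - 1"] by simp
  have dvd_iff: "?f dvd monom 1 n - [:k:] \<longleftrightarrow>
      lucas_U b c n = 0 \<and> k = - c * lucas_U b c (n - 1)" if "n > 0" for n k
    using quadratic_dvd_binomial_iff[of c b "n - 1" k] that by simp
  have "r \<le> degree p'" if "monic_binomial p'" "?f dvd p'" for p'
  proof -
    from that(1) obtain n k where n: "n > 0" and p': "p' = monom 1 n - [:k:]"
      unfolding monic_binomial_def by blast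
    have "lucas_U b c n = 0" using that(2) n p' dvd_iff by blast
    then have "r \<le> n" using assms(4)[of n] n by force
    then show ?thesis by (simp only: p' degree_monic_binomial[OF n])
  qed
  moreover have deg: "degree ?p = r"
    using assms(2) by (intro degree_monic_binomial) simp
  moreover have "monic_binomial ?p"
    unfolding monic_binomial_def using assms(2) l
    by (intro exI[of _ r] exI[of _ ?l]) simp
  moreover have "?f dvd ?p" using dvd_iff[of r ?l] assms(2,3) by simp
  ultimately have "is_minimal_binomial_multiple ?f ?p"
    unfolding is_minimal_binomial_multiple_def by simp
  \<comment> \<open>Uniqueness lets the \<open>THE\<close> in the definition be evaluated at
    \<open>?p\<close>.\<close>
  moreover have "\<exists>!p. is_minimal_binomial_multiple ?f p"
    using c by (intro minimal_binomial_multiple_ex1) auto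
  ultimately have min: "minimal_binomial_multiple ?f = ?p"
    unfolding minimal_binomial_multiple_def by (intro the1_equality)
  then have "binomial_order ?f = r"
    unfolding binomial_order_def using deg by simp
  then show ?thesis using min by simp
qed

end
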